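(* Suppose $(\eta_n)$ is a sequence of positive real numbers with $\eta_n\to0$. For every sequence $a_n$ of nonnegative real numbers we have, with $E_{A,n}=[\tilde\theta_A-\hat\sigma a_n,\tilde\theta_A+\hat\sigma a_n]$ and $C_{A,n}=[\hat\theta_A-a_n,\hat\theta_A+a_n]$, that $$\inf_{\theta\in\mathbb{R}}P_{n,\theta}(\theta\in E_{A,n})-\inf_{\theta\in\mathbb{R}}P_{n,\theta}(\theta\in C_{A,n})\to 0$$ as $n\to\infty$. The analogous results hold for the corresponding open and half-open intervals (i.e., when both $E_{A,n}$ and $C_{A,n}$ are replaced by the open, or by the left-open or right-open half-open, intervals with the same endpoints).
   Context: For $n\ge2$ the data $y_1,\dots,y_n$ are i.i.d. $N(\theta,1)$ with $\theta\in\mathbb{R}$; $P_{n,\theta}$ denotes the distribution of the sample when $\theta$ is the true parameter (true variance $\sigma^2=1$). Let $\bar y=n^{-1}\sum_{i=1}^n y_i$, $\hat\sigma^2=(n-1)^{-1}\sum_{i=1}^n(y_i-\bar y)^2$, $\hat\sigma=\sqrt{\hat\sigma^2}$. The feasible adaptive LASSO estimator is $\tilde\theta_A=0$ if $|\bar y|\le\hat\sigma\eta_n$ and $\tilde\theta_A=\bar y-\hat\sigma^2\eta_n^2/\bar y$ if $|\bar y|>\hat\sigma\eta_n$; its known-variance version is $\hat\theta_A=0$ if $|\bar y|\le\eta_n$ and $\hat\theta_A=\bar y-\eta_n^2/\bar y$ if $|\bar y|>\eta_n$. *)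

theory Defs
  imports "HOL-Probability.Probability"
begin

text \<open>A sample of size \<open>n\<close> is a function on the index set \<open>{1..n}\<close>; the values outside of it
  are \<open>undefined\<close> on the space of the product measure and are never used.\<close>

definition sample_dist :: "nat \<Rightarrow> real \<Rightarrow> (nat \<Rightarrow> real) measure" where
  "sample_dist n \<theta> = (\<Pi>\<^sub>M i\<in>{1..n}. density lborel (normal_density \<theta> 1))"

definition sample_mean :: "nat \<Rightarrow> (nat \<Rightarrow> real) \<Rightarrow> real" where
  "sample_mean n y = (\<Sum>i=1..n. y i) / real n"

definition sample_var :: "nat \<Rightarrow> (nat \<Rightarrow> real) \<Rightarrow> real" where
  "sample_var n y = (\<Sum>i=1..n. (y i - sample_mean n y)\<^sup>2) / (real n - 1)"

definition sample_sd :: "nat \<Rightarrow> (nat \<Rightarrow> real) \<Rightarrow> real" where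
  "sample_sd n y = sqrt (sample_var n y)"

definition adaptive_lasso :: "nat \<Rightarrow> real \<Rightarrow> (nat \<Rightarrow> real) \<Rightarrow> real" where
  "adaptive_lasso n \<eta> y =
     (if \<bar>sample_mean n y\<bar> \<le> \<eta> then 0
      else sample_mean n y - \<eta>\<^sup>2 / sample_mean n y)"

definition feasible_adaptive_lasso :: "nat \<Rightarrow> real \<Rightarrow> (nat \<Rightarrow> real) \<Rightarrow> real" where
  "feasible_adaptive_lasso n \<eta> y =
     (if \<bar>sample_mean n y\<bar> \<le> sample_sd n y * \<eta> then 0
      else sample_mean n y - sample_var n y * \<eta>\<^sup>2 / sample_mean n y)"

definition inf_coverage :: "nat \<Rightarrow> ((nat \<Rightarrow> real) \<Rightarrow> real set) \<Rightarrow> real" where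
  "inf_coverage n I =
     (INF \<theta>. measure (sample_dist n \<theta>) {y \<in> space (sample_dist n \<theta>). \<theta> \<in> I y})"

end

theory Submission
  imports Defs
begin

text \<open>Write \<open>T x z\<close> for the estimator with threshold \<open>x\<close> at sample mean \<open>z\<close>. The feasible interval is
  obtained from the known-variance interval by replacing the threshold \<open>\<eta>\<close> and the half-width \<open>a\<close>
  with \<open>s \<eta>\<close> and \<open>s a\<close>, where \<open>s\<close> is the sample standard deviation. By Chebyshev's inequality
  (\<open>sample_var_concentration\<close>), \<open>s\<close> is within \<open>\<delta> = M / \<surd>n\<close> of 1 up to probability of order
  \<open>1 / M\<^sup>2\<close>. Since \<open>T\<close> is Lipschitz in its threshold uniformly in \<open>z\<close> (\<open>thr_lipschitz\<close>), on this event
  the feasible interval covers \<open>\<theta>\<close> if the known-variance interval of half-width \<open>a - \<kappa>\<close> does, and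
  only if that of half-width \<open>a + \<kappa>\<close> does, where \<open>\<kappa>\<close> is of order \<open>\<delta> (\<eta> + a)\<close>. This comparison is made
  for each sample separately.

  It remains to compare infimal known-variance coverages for nearby half-widths. For a fixed
  \<open>\<theta>\<close> the coverage can jump in the half-width, because the estimator has an atom at 0; but
  a slightly larger half-width at a slightly larger parameter covers with almost the same
  probability (\<open>coverage_shift\<close>). The infimum over \<open>\<theta>\<close> hence depends on the half-width in a Lipschitz
  way, with a constant of order \<open>\<surd>n\<close>, the height of the density of the mean
  (\<open>inf_coverage_widen\<close>). If \<open>a \<le> \<eta> + \<delta>\<close>, the resulting error \<open>\<kappa> \<surd>n\<close> is of order
  \<open>M (\<eta> + M / \<surd>n)\<close>, which tends to 0. If \<open>a > \<eta> + \<delta>\<close>, both coverages are uniformly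
  close to 1, because the estimator is never farther from the mean than its threshold. Both cases
  are combined in \<open>inf_coverage_diff_bound\<close>; the limit follows on letting \<open>n\<close> and then \<open>M\<close> grow.\<close>

section \<open>The adaptive thresholding function\<close>

text \<open>Both estimators are \<open>thr\<close> at the sample mean. They differ only in the threshold, which is \<open>\<eta>\<close> in
  the one case and \<open>\<eta>\<close> times the sample standard deviation in the other, so that replacing the
  variance by its estimate becomes a perturbation of the first argument.\<close>

definition thr :: "real \<Rightarrow> real \<Rightarrow> real" where
  "thr x z = (if \<bar>z\<bar> \<le> x then 0 else z - x\<^sup>2 / z)"

lemma borel_measurable_thr [measurable]:
  assumes [measurable]: "f \<in> borel_measurable M" "g \<in> borel_measurable M"
  shows "(\<lambda>w. thr (f w) (g w)) \<in> borel_measurable M"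
  unfolding thr_def by measurable

lemma thr_minus [simp]: "thr x (- z) = - thr x z"
  by (simp add: thr_def)

text \<open>For \<open>z > 0\<close> the two branches agree on a formula in \<open>min x z\<close>, from which the dependence on the
  threshold can be read off without distinguishing cases.\<close>

lemma thr_pos:
  assumes "0 \<le> x" "0 < z"
  shows "thr x z = z - (min x z)\<^sup>2 / z"
  using assms by (auto simp: thr_def min_def power2_eq_square)

lemma thr_pos_iff:
  assumes "0 \<le> x"
  shows "0 < thr x z \<longleftrightarrow> x < z"
proof -
  have "x\<^sup>2 / z < z" if "x < z"
  proof -
    have "x\<^sup>2 < z\<^sup>2" using that assms by (simp add: power_strict_mono)
    then show ?thesis using that assms by (simp add: divide_simps power2_eq_square)
  qed
  moreover have "\<not> 0 < z - x\<^sup>2 / z" if "z < - x"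
  proof -
    have "x\<^sup>2 \<le> (- z)\<^sup>2" using that assms by (intro power_mono) auto
    then show ?thesis using that assms by (simp add: divide_simps power2_eq_square)
  qed
  ultimately show ?thesis using assms unfolding thr_def by (smt (verit))
qed

text \<open>Above the threshold \<open>z - x\<^sup>2 / z\<close> has derivative \<open>1 + x\<^sup>2 / z\<^sup>2 \<ge> 1\<close>. Preimages of short intervals
  that lie in the positive half-line are therefore at least as short, and have small probability.\<close>

lemma thr_expand:
  assumes "0 \<le> x" "0 < thr x z" "z \<le> z'"
  shows "z' - z \<le> thr x z' - thr x z"
proof -
  have "x < z" using assms thr_pos_iff by simp
  then have "x\<^sup>2 / z' \<le> x\<^sup>2 / z" using assms by (intro divide_left_mono) auto
  with \<open>x < z\<close> assms show ?thesis by (simp add: thr_def)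
qed

lemma thr_mono:
  assumes "0 \<le> x" "z \<le> z'"
  shows "thr x z \<le> thr x z'"
proof (cases "0 < thr x z")
  case True
  with thr_expand[OF assms(1) this assms(2)] assms show ?thesis by simp
next
  case False
  show ?thesis
  proof (cases "0 < thr x (- z')")
    case True
    with thr_expand[OF assms(1) this, of "-z"] assms show ?thesis by simp
  qed (use False in simp)
qed

lemma thr_near:
  assumes "0 \<le> x"
  shows "\<bar>thr x z - z\<bar> \<le> x"
proof (cases "\<bar>z\<bar> \<le> x")
  case False
  have "x\<^sup>2 / \<bar>z\<bar> \<le> x * \<bar>z\<bar> / \<bar>z\<bar>"
    unfolding power2_eq_square using False assms by (intro divide_right_mono mult_left_mono) auto
  then show ?thesis using False assms by (simp add: thr_def)
qed (simp add: thr_def)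

text \<open>The estimator is insensitive to its threshold, uniformly in the data: for \<open>z > 0\<close> the subtracted
  term \<open>m\<^sup>2 / z\<close> with \<open>m = min x z\<close> changes by \<open>(m - m') (m + m') / z\<close>, and \<open>m + m' \<le> 2 z\<close>. The
  uniformity matters because the infimum over the parameter is not confined to a bounded set.\<close>

lemma thr_lipschitz:
  assumes "0 \<le> x" "0 \<le> x'"
  shows "\<bar>thr x z - thr x' z\<bar> \<le> 2 * \<bar>x - x'\<bar>"
proof -
  have pos: "\<bar>thr x z - thr x' z\<bar> \<le> 2 * \<bar>x - x'\<bar>" if "0 < z" for z
  proof -
    define m m' where "m = min x z" and "m' = min x' z"
    have m: "0 \<le> m" "0 \<le> m'" "m \<le> z" "m' \<le> z" "\<bar>m - m'\<bar> \<le> \<bar>x - x'\<bar>"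
      using assms that by (auto simp: m_def m'_def)
    have "thr x z - thr x' z = - (m - m') * ((m + m') / z)"
      using that by (simp add: thr_pos assms m_def m'_def field_simps power2_eq_square)
    then have "\<bar>thr x z - thr x' z\<bar> = \<bar>m - m'\<bar> * ((m + m') / z)"
      using m that by (simp only: abs_mult abs_minus_cancel) simp
    also have "\<dots> \<le> \<bar>m - m'\<bar> * 2"
      using m that by (intro mult_left_mono) (auto simp: divide_simps)
    finally show ?thesis using m by simp
  qed
  consider "z > 0" | "z = 0" | "- z > 0" by linarith
  then show ?thesis
  proof cases
    case 2 then show ?thesis using assms by (simp add: thr_def)
  next
    case 3
    from pos[OF this] show ?thesis by simp
  qed (rule pos)
qed

section \<open>Coverage when the variance is known\<close>

abbreviation gauss :: "real \<Rightarrow> real \<Rightarrow> real measure" where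
  "gauss \<theta> \<sigma> \<equiv> density lborel (normal_density \<theta> \<sigma>)"

lemma gauss_affine:
  assumes "0 < \<sigma>" "\<alpha> \<noteq> 0" and [measurable]: "B \<in> sets borel"
  shows "measure (gauss (\<beta> + \<alpha> * \<theta>) (\<bar>\<alpha>\<bar> * \<sigma>)) B = measure (gauss \<theta> \<sigma>) {z. \<beta> + \<alpha> * z \<in> B}"
proof -
  interpret prob_space "gauss \<theta> \<sigma>" by (rule prob_space_normal_density) fact
  have "distributed (gauss \<theta> \<sigma>) lborel (\<lambda>z. z) (normal_density \<theta> \<sigma>)"
    by (auto simp: distributed_def distr_id2)
  from distributed_distr_eq_density[OF normal_density_affine[OF this assms(1,2), of \<beta>]]
  have "measure (gauss (\<beta> + \<alpha> * \<theta>) (\<bar>\<alpha>\<bar> * \<sigma>)) B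
      = measure (distr (gauss \<theta> \<sigma>) lborel (\<lambda>z. \<beta> + \<alpha> * z)) B" by simp
  also have "\<dots> = measure (gauss \<theta> \<sigma>) {z. \<beta> + \<alpha> * z \<in> B}"
    by (subst measure_distr) (auto simp: vimage_def)
  finally show ?thesis .
qed

text \<open>The normal density is at most \<open>1 / (\<sigma> \<surd>(2 \<pi>)) \<le> 1 / (2 \<sigma>)\<close>, and a set of diameter \<open>d\<close> lies in an
  interval of length \<open>2 d\<close> around any of its points.\<close>

lemma gauss_small_diam:
  assumes "0 < \<sigma>" "0 \<le> d" and [measurable]: "S \<in> sets borel"
    and diam: "\<And>x y. x \<in> S \<Longrightarrow> y \<in> S \<Longrightarrow> x \<le> y + d"
  shows "measure (gauss \<theta> \<sigma>) S \<le> d / \<sigma>"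
proof (cases "S = {}")
  case False
  then obtain z where z: "z \<in> S" by blast
  interpret prob_space "gauss \<theta> \<sigma>" by (rule prob_space_normal_density) fact
  define c where "c = 1 / (2 * \<sigma>)"
  have dens: "normal_density \<theta> \<sigma> w \<le> c" for w
  proof -
    have "2 * \<sigma> \<le> sqrt (2 * pi * \<sigma>\<^sup>2)"
      using assms pi_ge_two by (intro real_le_rsqrt) (simp add: power2_eq_square)
    then have "1 / sqrt (2 * pi * \<sigma>\<^sup>2) \<le> c"
      unfolding c_def using assms by (intro divide_left_mono) auto
    moreover have "exp (- (w - \<theta>)\<^sup>2 / (2 * \<sigma>\<^sup>2)) \<le> 1" by simp
    ultimately show ?thesis unfolding normal_density_def
      using mult_mono[of "1 / sqrt (2 * pi * \<sigma>\<^sup>2)" c _ 1] assms by (simp add: c_def)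
  qed
  have sub: "S \<subseteq> {z - d..z + d}" using diam[OF _ z] diam[OF z] by force
  have "emeasure (gauss \<theta> \<sigma>) S \<le> emeasure (gauss \<theta> \<sigma>) {z - d..z + d}"
    by (intro emeasure_mono) (use sub in auto)
  also have "\<dots> = (\<integral>\<^sup>+w. ennreal (normal_density \<theta> \<sigma> w) * indicator {z - d..z + d} w \<partial>lborel)"
    by (intro emeasure_density) auto
  also have "\<dots> \<le> (\<integral>\<^sup>+w. ennreal c * indicator {z - d..z + d} w \<partial>lborel)"
    by (intro nn_integral_mono mult_right_mono) (use dens in \<open>auto intro!: ennreal_leI\<close>)
  also have "\<dots> = ennreal c * ennreal (2 * d)"
    using assms by (subst nn_integral_cmult_indicator) auto
  also have "\<dots> = ennreal (d / \<sigma>)"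
    using assms by (simp add: c_def ennreal_mult[symmetric])
  finally show ?thesis
    using assms by (simp add: emeasure_eq_measure)
qed (use assms in simp)

text \<open>For a fixed parameter the coverage probability may jump as a function of the half-width \<open>A\<close>,
  because the estimator is zero with positive probability: the jump occurs when \<open>A\<close> passes
  \<open>\<bar>\<theta>\<bar>\<close>. Moving the parameter together with the half-width avoids this. The event of coverage says
  that the estimator lies between \<open>\<theta> - A\<close> and \<open>\<theta> + A\<close>; passing to \<open>\<theta> + 2 \<kappa>\<close> and \<open>A + \<kappa>\<close>
  changes these endpoints to \<open>\<theta> - A + \<kappa>\<close> and \<open>\<theta> + A + 3 \<kappa>\<close>, so the lower endpoint moves up and
  nothing can be gained there except through the translation of the data by \<open>2 \<kappa>\<close>. The part
  gained at the upper endpoint begins at \<open>\<theta> + A \<ge> 0\<close>, and above 0 the estimator has no atom.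

  In the proof both normal laws are coupled by the translation \<open>z \<mapsto> z + 2 \<kappa>\<close>. If the wide interval
  covers at \<open>z + 2 \<kappa>\<close> and the narrow one does not cover at \<open>z\<close>, then \<open>z\<close> belongs to one of two sets \<open>L\<close> and \<open>R\<close>, which have
  diameter at most \<open>2 \<kappa>\<close> by monotonicity and at most \<open>3 \<kappa>\<close> by expansion.\<close>

lemma coverage_shift:
  assumes "0 < \<sigma>" "0 \<le> x" "0 \<le> A" "0 < \<kappa>" "0 \<le> \<theta>"
  shows "measure (gauss (\<theta> + 2 * \<kappa>) \<sigma>) {z. \<bar>thr x z - (\<theta> + 2 * \<kappa>)\<bar> \<le> A + \<kappa>}
       \<le> measure (gauss \<theta> \<sigma>) {z. \<bar>thr x z - \<theta>\<bar> < A} + 5 * \<kappa> / \<sigma>"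
proof -
  interpret prob_space "gauss \<theta> \<sigma>" by (rule prob_space_normal_density) fact
  define T where "T = thr x"
  have [measurable]: "T \<in> borel_measurable borel" unfolding T_def by measurable
  define I where "I = {z. \<bar>T z - \<theta>\<bar> < A}"
  define L where "L = {z. T z \<le> \<theta> - A \<and> \<theta> - A + \<kappa> \<le> T (z + 2 * \<kappa>)}"
  define R where "R = {z. 0 < T z \<and> \<theta> + A \<le> T z \<and> T z \<le> \<theta> + A + 3 * \<kappa>}"
  have [measurable]: "I \<in> sets borel" "L \<in> sets borel" "R \<in> sets borel"
    unfolding I_def L_def R_def by measurable
  have mono: "T z \<le> T z'" if "z \<le> z'" for z z'
    unfolding T_def using thr_mono that assms by blast
  have "measure (gauss (\<theta> + 2 * \<kappa>) \<sigma>) {z. \<bar>T z - (\<theta> + 2 * \<kappa>)\<bar> \<le> A + \<kappa>}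
      = prob {z. 2 * \<kappa> + z \<in> {z. \<bar>T z - (\<theta> + 2 * \<kappa>)\<bar> \<le> A + \<kappa>}}"
    using gauss_affine[OF assms(1), of 1 "{z. \<bar>T z - (\<theta> + 2 * \<kappa>)\<bar> \<le> A + \<kappa>}" "2 * \<kappa>" \<theta>]
    by (simp add: add.commute)
  also have "\<dots> \<le> prob (I \<union> L \<union> R)"
  proof (intro finite_measure_mono subsetI)
    fix z assume "z \<in> {z. 2 * \<kappa> + z \<in> {z. \<bar>T z - (\<theta> + 2 * \<kappa>)\<bar> \<le> A + \<kappa>}}"
    then have z: "\<theta> - A + \<kappa> \<le> T (z + 2 * \<kappa>)" "T (z + 2 * \<kappa>) \<le> \<theta> + A + 3 * \<kappa>"
      by (auto simp: add.commute abs_le_iff)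
    moreover have "T z \<le> T (z + 2 * \<kappa>)" using mono assms by simp
    \<comment> \<open>If the upper endpoint is 0, then \<open>\<theta> = A = 0\<close> and a zero estimate already lies in \<open>L\<close>.\<close>
    moreover have "z \<in> I \<union> L" if "\<not> (0 < T z \<and> \<theta> + A \<le> T z)"
      using that z assms by (auto simp: I_def L_def abs_less_iff)
    ultimately show "z \<in> I \<union> L \<union> R" by (auto simp: R_def)
  qed simp
  also have "\<dots> \<le> prob I + prob L + prob R"
    using measure_Un_le[of "I \<union> L" "gauss \<theta> \<sigma>" R] measure_Un_le[of I "gauss \<theta> \<sigma>" L] by simp
  also have "prob L \<le> 2 * \<kappa> / \<sigma>"
  proof (rule gauss_small_diam)
    fix z z' assume "z \<in> L" "z' \<in> L"
    then show "z \<le> z' + 2 * \<kappa>"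
      using mono[of "z' + 2 * \<kappa>" z] assms by (force simp: L_def)
  qed (use assms in auto)
  also have "prob R \<le> 3 * \<kappa> / \<sigma>"
  proof (rule gauss_small_diam)
    fix z z' assume *: "z \<in> R" "z' \<in> R"
    show "z \<le> z' + 3 * \<kappa>"
    proof (cases "z' \<le> z")
      case True
      with thr_expand[of x z' z] * assms show ?thesis by (auto simp: R_def T_def)
    qed (use assms in auto)
  qed (use assms in auto)
  finally show ?thesis by (simp add: I_def T_def field_simps)
qed

lemma gauss_reflect_coverage:
  assumes "0 < \<sigma>"
  shows "measure (gauss (- \<theta>) \<sigma>) {z. \<bar>thr x z - (- \<theta>)\<bar> < A} = measure (gauss \<theta> \<sigma>) {z. \<bar>thr x z - \<theta>\<bar> < A}"
proof -
  have "\<bar>- thr x z + \<theta>\<bar> = \<bar>thr x z - \<theta>\<bar>" for z by simp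
  with gauss_affine[OF assms, of "-1" "{z. \<bar>thr x z - (- \<theta>)\<bar> < A}" 0 \<theta>] show ?thesis by simp
qed

lemma cINF_le_cINF_plus:
  fixes f g :: "real \<Rightarrow> real"
  assumes "\<And>\<theta>. 0 \<le> f \<theta>" "\<And>\<theta>. \<exists>\<theta>'. f \<theta>' \<le> g \<theta> + e"
  shows "(INF \<theta>. f \<theta>) \<le> (INF \<theta>. g \<theta>) + e"
proof -
  have "(INF \<theta>. f \<theta>) - e \<le> g \<theta>" for \<theta>
  proof -
    obtain \<theta>' where "f \<theta>' \<le> g \<theta> + e" using assms by blast
    moreover have "(INF \<theta>. f \<theta>) \<le> f \<theta>'"
      using assms by (intro cINF_lower bdd_belowI[of _ 0]) auto
    ultimately show ?thesis by simp
  qed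
  then have "(INF \<theta>. f \<theta>) - e \<le> (INF \<theta>. g \<theta>)" by (intro cINF_greatest) auto
  then show ?thesis by simp
qed

text \<open>Taking the infimum over the parameter absorbs the shift of \<open>\<theta>\<close>, so that the infimal coverage,
  unlike the coverage itself, is Lipschitz in the half-width. The reflection \<open>z \<mapsto> - z\<close> reduces
  negative parameters to positive ones.\<close>

lemma inf_coverage_widen:
  assumes "0 < \<sigma>" "0 \<le> x" "0 \<le> A" "0 < \<kappa>"
  shows "(INF \<theta>. measure (gauss \<theta> \<sigma>) {z. \<bar>thr x z - \<theta>\<bar> \<le> A + \<kappa>})
       \<le> (INF \<theta>. measure (gauss \<theta> \<sigma>) {z. \<bar>thr x z - \<theta>\<bar> < A}) + 5 * \<kappa> / \<sigma>"
proof (rule cINF_le_cINF_plus)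
  fix \<theta> :: real
  have "measure (gauss \<bar>\<theta>\<bar> \<sigma>) {z. \<bar>thr x z - \<bar>\<theta>\<bar>\<bar> < A} = measure (gauss \<theta> \<sigma>) {z. \<bar>thr x z - \<theta>\<bar> < A}"
    using gauss_reflect_coverage[OF assms(1), of \<theta> x A] by (cases "0 \<le> \<theta>") auto
  then show "\<exists>\<theta>'. measure (gauss \<theta>' \<sigma>) {z. \<bar>thr x z - \<theta>'\<bar> \<le> A + \<kappa>}
      \<le> measure (gauss \<theta> \<sigma>) {z. \<bar>thr x z - \<theta>\<bar> < A} + 5 * \<kappa> / \<sigma>"
    using coverage_shift[OF assms, of "\<bar>\<theta>\<bar>"] by (metis abs_ge_zero)
qed simp

section \<open>Sample mean and sample variance\<close>

lemma prob_space_sample_dist: "prob_space (sample_dist n \<theta>)"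
  unfolding sample_dist_def by (intro prob_space_PiM prob_space_normal_density) simp

lemma sets_sample_dist [measurable_cong]: "sets (sample_dist n \<theta>) = sets (\<Pi>\<^sub>M i\<in>{1..n}. borel)"
  unfolding sample_dist_def by (intro sets_PiM_cong) auto

lemma sample_coordinate_distributed:
  assumes "i \<in> {1..n}"
  shows "distributed (sample_dist n \<theta>) lborel (\<lambda>y. y i) (normal_density \<theta> 1)"
proof -
  have "distr (sample_dist n \<theta>) (density lborel (normal_density \<theta> 1)) (\<lambda>y. y i)
      = density lborel (normal_density \<theta> 1)"
    unfolding sample_dist_def using assms
    by (intro distr_PiM_component prob_space_normal_density) auto
  moreover have "distr (sample_dist n \<theta>) lborel (\<lambda>y. y i)
      = distr (sample_dist n \<theta>) (density lborel (normal_density \<theta> 1)) (\<lambda>y. y i)"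
    by (intro distr_cong) auto
  moreover have "(\<lambda>y. y i) \<in> borel_measurable (sample_dist n \<theta>)"
    using assms by measurable
  ultimately show ?thesis unfolding distributed_def by simp
qed

lemma sample_coordinates_indep:
  assumes "1 \<le> n"
  shows "prob_space.indep_vars (sample_dist n \<theta>) (\<lambda>_. borel) (\<lambda>i y. y i) {1..n}"
proof -
  interpret prob_space "sample_dist n \<theta>" by (rule prob_space_sample_dist)
  have meas: "random_variable borel (\<lambda>y. y i)" if "i \<in> {1..n}" for i
    using that by measurable
  have marg: "distr (sample_dist n \<theta>) borel (\<lambda>y. y i) = density lborel (normal_density \<theta> 1)"
    if "i \<in> {1..n}" for i
  proof -
    have "distr (sample_dist n \<theta>) borel (\<lambda>y. y i) = distr (sample_dist n \<theta>) lborel (\<lambda>y. y i)"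
      by (intro distr_cong) auto
    also have "\<dots> = density lborel (normal_density \<theta> 1)"
      by (intro distributed_distr_eq_density sample_coordinate_distributed that)
    finally show ?thesis .
  qed
  have "distr (sample_dist n \<theta>) (\<Pi>\<^sub>M i\<in>{1..n}. borel) (\<lambda>y. \<lambda>i\<in>{1..n}. y i)
      = distr (sample_dist n \<theta>) (sample_dist n \<theta>) (\<lambda>y. y)"
  proof (intro distr_cong)
    show "(\<lambda>i\<in>{1..n}. y i) = y" if "y \<in> space (sample_dist n \<theta>)" for y
      using that by (simp add: sample_dist_def space_PiM PiE_restrict)
  qed (simp_all add: sets_sample_dist)
  also have "\<dots> = sample_dist n \<theta>" by (rule distr_id)
  also have "\<dots> = (\<Pi>\<^sub>M i\<in>{1..n}. distr (sample_dist n \<theta>) borel (\<lambda>y. y i))"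
    by (subst sample_dist_def) (intro PiM_cong refl marg[symmetric])
  finally show ?thesis
    using assms meas by (subst indep_vars_iff_distr_eq_PiM') auto
qed

lemma borel_measurable_sample_mean [measurable]: "sample_mean n \<in> borel_measurable (sample_dist n \<theta>)"
  unfolding sample_mean_def by measurable

lemma borel_measurable_sample_var [measurable]: "sample_var n \<in> borel_measurable (sample_dist n \<theta>)"
  unfolding sample_var_def by measurable

lemma borel_measurable_sample_sd [measurable]: "sample_sd n \<in> borel_measurable (sample_dist n \<theta>)"
  unfolding sample_sd_def by measurable

lemma sample_mean_distributed:
  assumes "1 \<le> n"
  shows "distributed (sample_dist n \<theta>) lborel (sample_mean n) (normal_density \<theta> (1 / sqrt n))"
proof -
  interpret prob_space "sample_dist n \<theta>" by (rule prob_space_sample_dist)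
  have "distributed (sample_dist n \<theta>) lborel (\<lambda>y. \<Sum>i\<in>{1..n}. y i)
      (normal_density (\<Sum>i\<in>{1..n}. \<theta>) (sqrt (\<Sum>i\<in>{1..n}. 1\<^sup>2)))"
    using assms sample_coordinates_indep sample_coordinate_distributed
    by (intro sum_indep_normal) auto
  then have "distributed (sample_dist n \<theta>) lborel (\<lambda>y. \<Sum>i=1..n. y i) (normal_density (real n * \<theta>) (sqrt n))"
    by simp
  from normal_density_affine[OF this, of "1 / real n" 0]
  have "distributed (sample_dist n \<theta>) lborel (\<lambda>y. (\<Sum>i=1..n. y i) / real n) (normal_density \<theta> (sqrt n / n))"
    using assms by simp
  moreover have "sqrt n / n = 1 / sqrt n"
    using assms by (simp add: field_simps)
  ultimately show ?thesis unfolding sample_mean_def by simp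
qed

text \<open>The second and fourth moments of the standard normal law are 1 and 3.\<close>

lemma (in prob_space) standard_normal_square_centered:
  assumes "distributed M lborel X std_normal_density"
  shows "expectation (\<lambda>w. (X w)\<^sup>2 - 1) = 0" "integrable M (\<lambda>w. ((X w)\<^sup>2 - 1)\<^sup>2)"
    "expectation (\<lambda>w. ((X w)\<^sup>2 - 1)\<^sup>2) = 2"
proof -
  have int: "integrable M (\<lambda>w. X w ^ (2 * k))" and
    ex: "expectation (\<lambda>w. X w ^ (2 * k)) = fact (2 * k) / (2^k * fact k)" for k
    using distributed_integrable[OF assms, of "\<lambda>x. x ^ (2 * k)"] integrable_std_normal_moment[of "2 * k"]
      distributed_integral[OF assms, of "\<lambda>x. x ^ (2 * k)"] integral_std_normal_moment_even[of k]
    by auto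
  have eq: "(\<lambda>w. ((X w)\<^sup>2 - 1)\<^sup>2) = (\<lambda>w. X w ^ 4 - 2 * (X w)\<^sup>2 + 1)"
    by (auto simp: power2_eq_square power4_eq_xxxx algebra_simps)
  show "expectation (\<lambda>w. (X w)\<^sup>2 - 1) = 0"
    using int[of 1] ex[of 1] by (simp add: prob_space)
  show "integrable M (\<lambda>w. ((X w)\<^sup>2 - 1)\<^sup>2)" "expectation (\<lambda>w. ((X w)\<^sup>2 - 1)\<^sup>2) = 2"
    unfolding eq using int[of 1] ex[of 1] int[of 2] ex[of 2] by (simp_all add: prob_space fact_numeral)
qed

lemma (in prob_space) second_moment_indep_sum:
  fixes X :: "'i \<Rightarrow> 'a \<Rightarrow> real"
  assumes "finite I" and indep: "indep_vars (\<lambda>_. borel) X I"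
    and int: "\<And>i. i \<in> I \<Longrightarrow> integrable M (\<lambda>w. (X i w)\<^sup>2)"
    and centered: "\<And>i. i \<in> I \<Longrightarrow> expectation (X i) = 0"
  shows "integrable M (\<lambda>w. (\<Sum>i\<in>I. X i w)\<^sup>2)"
    "expectation (\<lambda>w. (\<Sum>i\<in>I. X i w)\<^sup>2) = (\<Sum>i\<in>I. expectation (\<lambda>w. (X i w)\<^sup>2))"
proof -
  have int1: "integrable M (X i)" if "i \<in> I" for i
  proof (rule square_integrable_imp_integrable)
    show "random_variable borel (X i)" using indep that unfolding indep_vars_def by blast
  qed (rule int[OF that])
  have cross: "integrable M (\<lambda>w. X i w * X j w) \<and> expectation (\<lambda>w. X i w * X j w) = 0"
    if "i \<in> I" "j \<in> I" "i \<noteq> j" for i j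
  proof -
    have "indep_vars (\<lambda>_. borel) X {i, j}" using indep that by (auto intro: indep_vars_subset)
    moreover have "integrable M (X k)" if "k \<in> {i, j}" for k
      using that \<open>i \<in> I\<close> \<open>j \<in> I\<close> int1 by blast
    ultimately show ?thesis
      using indep_vars_lebesgue_integral[of "{i, j}" X] indep_vars_integrable[of "{i, j}" X]
        that(3) centered[OF that(1)] by simp
  qed
  have all: "integrable M (\<lambda>w. X i w * X j w)" if "i \<in> I" "j \<in> I" for i j
    using cross int that by (cases "i = j") (auto simp: power2_eq_square)
  have sq: "(\<lambda>w. (\<Sum>i\<in>I. X i w)\<^sup>2) = (\<lambda>w. \<Sum>i\<in>I. \<Sum>j\<in>I. X i w * X j w)"
    by (simp add: power2_eq_square sum_product)
  show "integrable M (\<lambda>w. (\<Sum>i\<in>I. X i w)\<^sup>2)"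
    unfolding sq using all by auto
  have "expectation (\<lambda>w. (\<Sum>i\<in>I. X i w)\<^sup>2) = (\<Sum>i\<in>I. \<Sum>j\<in>I. expectation (\<lambda>w. X i w * X j w))"
    unfolding sq using all by (simp add: Bochner_Integration.integral_sum)
  also have "\<dots> = (\<Sum>i\<in>I. \<Sum>j\<in>I. if j = i then expectation (\<lambda>w. (X i w)\<^sup>2) else 0)"
    using cross by (intro sum.cong refl) (auto simp: power2_eq_square)
  finally show "expectation (\<lambda>w. (\<Sum>i\<in>I. X i w)\<^sup>2) = (\<Sum>i\<in>I. expectation (\<lambda>w. (X i w)\<^sup>2))"
    using assms(1) by simp
qed

text \<open>Up to the factor \<open>n - 1\<close>, the error of the sample variance is a sum of \<open>n\<close> independent centred
  squares minus a single centred square. The second moments of the two parts are \<open>2 n\<close> and 2, so the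
  error is of order \<open>1 / \<surd>n\<close> in mean square.\<close>

lemma sample_var_decomposition:
  assumes "2 \<le> n"
  shows "(real n - 1) * (sample_var n y - 1)
    = (\<Sum>i=1..n. (y i - \<theta>)\<^sup>2 - 1) - ((sqrt n * (sample_mean n y - \<theta>))\<^sup>2 - 1)"
proof -
  define m where "m = sample_mean n y"
  have S: "(\<Sum>i=1..n. y i) = real n * m" using assms by (simp add: m_def sample_mean_def)
  have "(real n - 1) * sample_var n y = (\<Sum>i=1..n. (y i - m)\<^sup>2)"
    using assms by (simp add: sample_var_def m_def)
  also have "\<dots> = (\<Sum>i=1..n. (y i - \<theta>)\<^sup>2 - 2 * (m - \<theta>) * y i + (m\<^sup>2 - \<theta>\<^sup>2))"
    by (intro sum.cong) (auto simp: power2_eq_square algebra_simps)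
  also have "\<dots> = (\<Sum>i=1..n. (y i - \<theta>)\<^sup>2) - 2 * (m - \<theta>) * (real n * m) + real n * (m\<^sup>2 - \<theta>\<^sup>2)"
    by (simp add: sum.distrib sum_subtractf sum_distrib_left[symmetric] S del: One_nat_def)
  also have "\<dots> = (\<Sum>i=1..n. (y i - \<theta>)\<^sup>2) - real n * (m - \<theta>)\<^sup>2"
    by (simp add: power2_eq_square algebra_simps)
  finally have "(real n - 1) * sample_var n y = (\<Sum>i=1..n. (y i - \<theta>)\<^sup>2) - real n * (m - \<theta>)\<^sup>2" .
  moreover have "(sqrt n * (m - \<theta>))\<^sup>2 = real n * (m - \<theta>)\<^sup>2"
    by (simp add: power_mult_distrib)
  moreover have "(\<Sum>i=1..n. (y i - \<theta>)\<^sup>2 - 1) = (\<Sum>i=1..n. (y i - \<theta>)\<^sup>2) - real n"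
    by (simp add: sum_subtractf)
  ultimately show ?thesis
    unfolding m_def by (simp only: right_diff_distrib) simp
qed

lemma sample_var_concentration:
  assumes "2 \<le> n" "0 < \<delta>"
  shows "measure (sample_dist n \<theta>) {y \<in> space (sample_dist n \<theta>). \<delta> \<le> \<bar>sample_var n y - 1\<bar>} \<le> 24 / (real n * \<delta>\<^sup>2)"
proof -
  interpret prob_space "sample_dist n \<theta>" by (rule prob_space_sample_dist)
  define X where "X i y = (y i - \<theta>)\<^sup>2 - 1" for i :: nat and y :: "nat \<Rightarrow> real"
  define W where "W y = (\<Sum>i=1..n. X i y)" for y
  define V where "V y = (sqrt n * (sample_mean n y - \<theta>))\<^sup>2 - 1" for y
  have X: "expectation (X i) = 0" "integrable (sample_dist n \<theta>) (\<lambda>y. (X i y)\<^sup>2)"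
      "expectation (\<lambda>y. (X i y)\<^sup>2) = 2" if "i \<in> {1..n}" for i
    using standard_normal_square_centered[of "\<lambda>y. y i - \<theta>"]
      sample_coordinate_distributed[OF that, of \<theta>] normal_standard_normal_convert[of 1 "\<lambda>y. y i" \<theta>]
    unfolding X_def by auto
  have "indep_vars (\<lambda>_. borel) X {1..n}"
    unfolding X_def using assms
    by (intro indep_vars_compose2[OF sample_coordinates_indep]) auto
  then have W: "integrable (sample_dist n \<theta>) (\<lambda>y. (W y)\<^sup>2)" "expectation (\<lambda>y. (W y)\<^sup>2) = 2 * real n"
    unfolding W_def using second_moment_indep_sum[of "{1..n}" X] X by auto
  have "distributed (sample_dist n \<theta>) lborel (\<lambda>y. sqrt n * (sample_mean n y - \<theta>)) std_normal_density"
    using sample_mean_distributed[of n \<theta>] normal_standard_normal_convert[of "1 / sqrt n" "sample_mean n" \<theta>] assms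
    by (simp add: mult.commute)
  then have V: "integrable (sample_dist n \<theta>) (\<lambda>y. (V y)\<^sup>2)" "expectation (\<lambda>y. (V y)\<^sup>2) = 2"
    unfolding V_def by (rule standard_normal_square_centered)+
  have [measurable]: "V \<in> borel_measurable (sample_dist n \<theta>)" "W \<in> borel_measurable (sample_dist n \<theta>)"
    unfolding V_def W_def X_def by measurable
  define D where "D y = sample_var n y - 1" for y
  have [measurable]: "D \<in> borel_measurable (sample_dist n \<theta>)" unfolding D_def by measurable
  have bound: "(D y)\<^sup>2 \<le> (2 * (W y)\<^sup>2 + 2 * (V y)\<^sup>2) / (real n - 1)\<^sup>2" for y
  proof -
    have "((real n - 1) * D y)\<^sup>2 = (W y - V y)\<^sup>2"
      using sample_var_decomposition[OF assms(1), of y \<theta>] unfolding D_def W_def V_def X_def by simp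
    also have "\<dots> \<le> 2 * (W y)\<^sup>2 + 2 * (V y)\<^sup>2"
      using zero_le_power2[of "W y + V y"] by (simp add: power2_eq_square algebra_simps)
    finally show ?thesis using assms unfolding power_mult_distrib by (simp add: pos_le_divide_eq mult.commute)
  qed
  have intR: "integrable (sample_dist n \<theta>) (\<lambda>y. (2 * (W y)\<^sup>2 + 2 * (V y)\<^sup>2) / (real n - 1)\<^sup>2)"
    using W V by auto
  have intD: "integrable (sample_dist n \<theta>) (\<lambda>y. (D y)\<^sup>2)"
    by (rule Bochner_Integration.integrable_bound[OF intR]) (use bound in \<open>auto intro!: order_trans[OF bound]\<close>)
  have "expectation (\<lambda>y. (D y)\<^sup>2) \<le> expectation (\<lambda>y. (2 * (W y)\<^sup>2 + 2 * (V y)\<^sup>2) / (real n - 1)\<^sup>2)"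
    by (intro integral_mono intR intD bound)
  also have "\<dots> = (4 * real n + 4) / (real n - 1)\<^sup>2"
    using W V by simp
  also have "\<dots> \<le> 24 / real n"
  proof -
    obtain k where k: "n = k + 2" using assms by (metis add.commute le_Suc_ex)
    have "(4 * real n + 4) * real n \<le> 24 * (real n - 1)\<^sup>2"
      by (simp add: k power2_eq_square algebra_simps)
    then show ?thesis using assms by (simp add: divide_simps)
  qed
  finally have E: "expectation (\<lambda>y. (D y)\<^sup>2) \<le> 24 / real n" .
  have "prob {y \<in> space (sample_dist n \<theta>). \<delta> \<le> \<bar>D y\<bar>} \<le> expectation (\<lambda>y. (D y)\<^sup>2) / \<delta>\<^sup>2"
    using second_moment_method[of D \<delta>] intD assms by simp
  also have "\<dots> \<le> (24 / real n) / \<delta>\<^sup>2" using E by (intro divide_right_mono) auto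
  finally show ?thesis by (simp add: D_def)
qed

section \<open>Comparison of the infimal coverage probabilities\<close>

lemma adaptive_lasso_eq_thr: "adaptive_lasso n \<eta> y = thr \<eta> (sample_mean n y)"
  by (simp add: adaptive_lasso_def thr_def)

lemma sample_var_nonneg: "1 \<le> n \<Longrightarrow> 0 \<le> sample_var n y"
  unfolding sample_var_def by (intro divide_nonneg_nonneg sum_nonneg) auto

lemma feasible_adaptive_lasso_eq_thr:
  assumes "1 \<le> n"
  shows "feasible_adaptive_lasso n \<eta> y = thr (sample_sd n y * \<eta>) (sample_mean n y)"
  using sample_var_nonneg[OF assms, of y]
  by (simp add: feasible_adaptive_lasso_def thr_def sample_sd_def power_mult_distrib)

text \<open>\<open>\<bar>s - 1\<bar> \<le> \<bar>s - 1\<bar> (s + 1) = \<bar>s\<^sup>2 - 1\<bar>\<close> for \<open>s \<ge> 0\<close>.\<close>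

lemma sample_sd_near_1:
  assumes "1 \<le> n" "\<bar>sample_var n y - 1\<bar> < \<delta>"
  shows "\<bar>sample_sd n y - 1\<bar> < \<delta>"
proof -
  define s where "s = sample_sd n y"
  have s: "0 \<le> s" "s\<^sup>2 = sample_var n y"
    using sample_var_nonneg[OF assms(1), of y] by (auto simp: s_def sample_sd_def)
  have "\<bar>s - 1\<bar> * 1 \<le> \<bar>s - 1\<bar> * (s + 1)"
    using s by (intro mult_left_mono) auto
  also have "\<dots> = \<bar>(s - 1) * (s + 1)\<bar>"
    using s by (simp add: abs_mult)
  also have "(s - 1) * (s + 1) = sample_var n y - 1"
    unfolding s(2)[symmetric] by (simp add: power2_eq_square algebra_simps)
  finally show ?thesis using assms by (simp add: s_def)
qed

lemma prob_sample_mean: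
  assumes "1 \<le> n" and [measurable]: "S \<in> sets borel"
  shows "measure (sample_dist n \<theta>) {y \<in> space (sample_dist n \<theta>). sample_mean n y \<in> S}
    = measure (gauss \<theta> (1 / sqrt n)) S"
proof -
  have "measure (gauss \<theta> (1 / sqrt n)) S = measure (distr (sample_dist n \<theta>) lborel (sample_mean n)) S"
    by (simp only: distributed_distr_eq_density[OF sample_mean_distributed[OF assms(1)]])
  also have "\<dots> = measure (sample_dist n \<theta>) (sample_mean n -` S \<inter> space (sample_dist n \<theta>))"
    by (intro measure_distr) auto
  also have "sample_mean n -` S \<inter> space (sample_dist n \<theta>) = {y \<in> space (sample_dist n \<theta>). sample_mean n y \<in> S}"
    by auto
  finally show ?thesis by simp
qed

lemma sample_mean_concentration:
  assumes "1 \<le> n" "0 < c"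
  shows "measure (sample_dist n \<theta>) {y \<in> space (sample_dist n \<theta>). c \<le> \<bar>sample_mean n y - \<theta>\<bar>}
    \<le> 1 / (real n * c\<^sup>2)"
proof -
  interpret prob_space "sample_dist n \<theta>" by (rule prob_space_sample_dist)
  define X where "X y = sqrt n * (sample_mean n y - \<theta>)" for y
  have [measurable]: "X \<in> borel_measurable (sample_dist n \<theta>)" unfolding X_def by measurable
  have D: "distributed (sample_dist n \<theta>) lborel X std_normal_density"
    using sample_mean_distributed[OF assms(1), of \<theta>] assms
      normal_standard_normal_convert[of "1 / sqrt n" "sample_mean n" \<theta>]
    by (simp add: mult.commute X_def[abs_def])
  have "integrable (sample_dist n \<theta>) (\<lambda>y. (X y)\<^sup>2)" "expectation (\<lambda>y. (X y)\<^sup>2) = 1"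
    using distributed_integrable[OF D, of "\<lambda>x. x\<^sup>2"] integrable_std_normal_moment[of 2]
      distributed_integral[OF D, of "\<lambda>x. x\<^sup>2"] integral_std_normal_moment_even[of 1]
    by auto
  then have "prob {y \<in> space (sample_dist n \<theta>). sqrt n * c \<le> \<bar>X y\<bar>} \<le> 1 / (sqrt n * c)\<^sup>2"
    using second_moment_method[of X "sqrt n * c"] assms by simp
  moreover have "sqrt n * c \<le> \<bar>X y\<bar> \<longleftrightarrow> c \<le> \<bar>sample_mean n y - \<theta>\<bar>" for y
    using assms by (simp add: X_def abs_mult)
  ultimately show ?thesis by (simp add: power_mult_distrib)
qed

lemma INF_between:
  fixes f :: "real \<Rightarrow> real"
  assumes "\<And>\<theta>. l \<le> f \<theta>" "\<And>\<theta>. f \<theta> \<le> u"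
  shows "l \<le> (INF \<theta>. f \<theta>)" "(INF \<theta>. f \<theta>) \<le> u"
proof -
  show "l \<le> (INF \<theta>. f \<theta>)" using assms by (intro cINF_greatest) auto
  have "(INF \<theta>. f \<theta>) \<le> f 0" using assms by (intro cINF_lower bdd_belowI[of _ l]) auto
  then show "(INF \<theta>. f \<theta>) \<le> u" using assms(2)[of 0] by simp
qed

text \<open>The parameter \<open>M\<close> fixes the scale \<open>\<delta> = M / \<surd>n\<close> on which the sample variance and the sample mean
  are localised, at the cost of probability \<open>28 / M\<^sup>2\<close>. The set \<open>J c h\<close> may be anything between the
  open and the closed interval with centre \<open>c\<close> and half-width \<open>h\<close>, subject to measurability, which
  treats all kinds of intervals at once.

  If \<open>a > \<eta> + \<delta>\<close>, the interval covers whenever mean and variance are localised, because the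
  estimator is within its threshold of the mean; both infima are then nearly 1. Otherwise \<open>a\<close> is
  at most \<open>\<eta> + \<delta>\<close>, and a localised standard deviation alters the estimator and the half-width by
  no more than \<open>\<kappa> = \<delta> (3 \<eta> + \<delta>)\<close> in total. The feasible coverage is therefore trapped between known-variance
  coverages with half-widths \<open>a - \<kappa>\<close> and \<open>a + \<kappa>\<close>, whose infima differ from the one for \<open>a\<close> by at
  most a multiple of \<open>\<kappa> \<surd>n = M (3 \<eta> + \<delta>)\<close>.\<close>

lemma inf_coverage_diff_bound:
  fixes J :: "real \<Rightarrow> real \<Rightarrow> real set"
  assumes n: "2 \<le> n" and \<eta>: "0 \<le> \<eta>" and a: "0 \<le> a" and M: "0 < M" "M / sqrt n \<le> 1 / 2"
    and J_lower: "\<And>c h. {c - h<..<c + h} \<subseteq> J c h"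
    and J_upper: "\<And>c h. J c h \<subseteq> {c - h..c + h}"
    and J_meas: "\<And>\<theta>. Measurable.pred (borel \<Otimes>\<^sub>M borel) (\<lambda>p. \<theta> \<in> J (fst p) (snd p))"
  shows "\<bar>inf_coverage n (\<lambda>y. J (feasible_adaptive_lasso n \<eta> y) (sample_sd n y * a))
      - inf_coverage n (\<lambda>y. J (adaptive_lasso n \<eta> y) a)\<bar>
    \<le> 28 / M\<^sup>2 + 5 * M * (3 * \<eta> + M / sqrt n)"
proof -
  define \<delta> where "\<delta> = M / sqrt n"
  define \<sigma> where "\<sigma> = 1 / sqrt n"
  have n1: "1 \<le> n" and \<sigma>: "0 < \<sigma>" and \<delta>: "0 < \<delta>" "\<delta> \<le> 1 / 2" "real n * \<delta>\<^sup>2 = M\<^sup>2"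
    using n M by (auto simp: \<delta>_def \<sigma>_def power_divide)
  define S where "S \<theta> = space (sample_dist n \<theta>)" for \<theta>
  define q where "q \<theta> = measure (sample_dist n \<theta>)
    {y \<in> S \<theta>. \<theta> \<in> J (thr (sample_sd n y * \<eta>) (sample_mean n y)) (sample_sd n y * a)}" for \<theta>
  define p where "p \<theta> = measure (sample_dist n \<theta>) {y \<in> S \<theta>. \<theta> \<in> J (thr \<eta> (sample_mean n y)) a}" for \<theta>
  have iq: "inf_coverage n (\<lambda>y. J (feasible_adaptive_lasso n \<eta> y) (sample_sd n y * a)) = (INF \<theta>. q \<theta>)"
    by (simp add: inf_coverage_def q_def S_def feasible_adaptive_lasso_eq_thr[OF n1])
  have ip: "inf_coverage n (\<lambda>y. J (adaptive_lasso n \<eta> y) a) = (INF \<theta>. p \<theta>)"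
    by (simp add: inf_coverage_def p_def S_def adaptive_lasso_eq_thr)
  have J_pred: "{y \<in> S \<theta>. \<theta> \<in> J (f y) (h y)} \<in> sets (sample_dist n \<theta>)"
    if [measurable]: "f \<in> borel_measurable (sample_dist n \<theta>)" "h \<in> borel_measurable (sample_dist n \<theta>)" for f h \<theta>
  proof -
    have "(\<lambda>y. (f y, h y)) \<in> sample_dist n \<theta> \<rightarrow>\<^sub>M borel \<Otimes>\<^sub>M borel" by measurable
    from measurable_compose[OF this J_meas] show ?thesis unfolding S_def pred_def by simp
  qed
  have meas_q: "{y \<in> S \<theta>. \<theta> \<in> J (thr (sample_sd n y * \<eta>) (sample_mean n y)) (sample_sd n y * a)}
      \<in> sets (sample_dist n \<theta>)" for \<theta>
    by (rule J_pred) measurable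
  have meas_p: "{y \<in> S \<theta>. \<theta> \<in> J (thr \<eta> (sample_mean n y)) a} \<in> sets (sample_dist n \<theta>)" for \<theta>
    by (rule J_pred) measurable
  have q01: "0 \<le> q \<theta>" "q \<theta> \<le> 1" and p01: "0 \<le> p \<theta>" "p \<theta> \<le> 1" for \<theta>
    using prob_space.prob_le_1[OF prob_space_sample_dist] by (auto simp: q_def p_def)
  \<comment> \<open>The exceptional event: off it the standard deviation is within \<open>\<delta>\<close> of 1.\<close>
  define var_off where "var_off \<theta> = {y \<in> S \<theta>. \<delta> \<le> \<bar>sample_var n y - 1\<bar>}" for \<theta>
  have meas_var_off: "var_off \<theta> \<in> sets (sample_dist n \<theta>)" for \<theta> unfolding var_off_def S_def by measurable
  have prob_var_off: "measure (sample_dist n \<theta>) (var_off \<theta>) \<le> 24 / M\<^sup>2" for \<theta>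
    using sample_var_concentration[OF n \<delta>(1), of \<theta>] by (simp add: var_off_def S_def \<delta>)
  have good: "\<bar>sample_sd n y - 1\<bar> < \<delta>" if "y \<in> S \<theta>" "y \<notin> var_off \<theta>" for y \<theta>
    using that sample_sd_near_1[OF n1] by (auto simp: var_off_def)
  have measure_le_up_to: "measure (sample_dist n \<theta>) X \<le> measure (sample_dist n \<theta>) Y + e"
    if "X \<subseteq> Y \<union> Z" "Y \<in> sets (sample_dist n \<theta>)" "Z \<in> sets (sample_dist n \<theta>)" "measure (sample_dist n \<theta>) Z \<le> e"
    for X Y Z \<theta> e
  proof -
    interpret prob_space "sample_dist n \<theta>" by (rule prob_space_sample_dist)
    have "prob X \<le> prob (Y \<union> Z)" using that by (intro finite_measure_mono) auto
    also have "\<dots> \<le> prob Y + prob Z" using that by (intro measure_Un_le) auto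
    finally show ?thesis using that by simp
  qed
  show ?thesis
  proof (cases "\<eta> + \<delta> < a")
    case True
    have low: "1 - 28 / M\<^sup>2 \<le> q \<theta> \<and> 1 - 28 / M\<^sup>2 \<le> p \<theta>" for \<theta>
    proof -
      interpret prob_space "sample_dist n \<theta>" by (rule prob_space_sample_dist)
      define far where "far = {y \<in> S \<theta>. \<delta> / 2 \<le> \<bar>sample_mean n y - \<theta>\<bar>}"
      have [measurable]: "far \<in> sets (sample_dist n \<theta>)" unfolding far_def S_def by measurable
      have "prob far \<le> 4 / M\<^sup>2"
        using sample_mean_concentration[OF n1, of "\<delta> / 2" \<theta>] \<delta>
        by (simp add: far_def S_def power_divide)
      then have Z: "prob (var_off \<theta> \<union> far) \<le> 28 / M\<^sup>2"
        using measure_Un_le[OF meas_var_off, of far \<theta>] prob_var_off[of \<theta>] by simp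
      have covered: "\<theta> \<in> J (thr (s * \<eta>) m) (s * a)" if "1 / 2 \<le> s" "\<bar>m - \<theta>\<bar> < \<delta> / 2" for s m
      proof -
        have "s * (\<eta> + \<delta>) \<le> s * a" using True that by (intro mult_left_mono) auto
        moreover have "1 / 2 * \<delta> \<le> s * \<delta>" using that \<delta> by (intro mult_right_mono) auto
        moreover have "\<bar>thr (s * \<eta>) m - m\<bar> \<le> s * \<eta>" using that \<eta> by (intro thr_near) auto
        ultimately have "\<bar>thr (s * \<eta>) m - \<theta>\<bar> < s * a" using that unfolding distrib_left by linarith
        then show ?thesis using J_lower by (force simp: abs_less_iff)
      qed
      have sd: "1 / 2 \<le> sample_sd n y" if "y \<in> S \<theta>" "y \<notin> var_off \<theta>" for y
        using good[OF that] \<delta> by linarith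
      have near: "\<bar>sample_mean n y - \<theta>\<bar> < \<delta> / 2" if "y \<in> S \<theta>" "y \<notin> far" for y
        using that unfolding far_def by force
      have Z_meas: "var_off \<theta> \<union> far \<in> sets (sample_dist n \<theta>)" using meas_var_off by auto
      have "prob (S \<theta>) \<le> q \<theta> + 28 / M\<^sup>2" unfolding q_def
        by (rule measure_le_up_to[OF _ meas_q Z_meas Z]) (use covered[OF sd near] in blast)
      moreover have "prob (S \<theta>) \<le> p \<theta> + 28 / M\<^sup>2" unfolding p_def
        by (rule measure_le_up_to[OF _ meas_p Z_meas Z]) (use covered[of 1, OF _ near] in auto)
      ultimately show ?thesis by (simp add: S_def prob_space)
    qed
    have "\<bar>(INF \<theta>. q \<theta>) - (INF \<theta>. p \<theta>)\<bar> \<le> 28 / M\<^sup>2"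
      using INF_between[of "1 - 28 / M\<^sup>2" q 1] INF_between[of "1 - 28 / M\<^sup>2" p 1] low q01 p01
      by (auto simp: abs_le_iff)
    moreover have "0 \<le> 5 * M * (3 * \<eta> + M / sqrt n)" using M \<eta> by simp
    ultimately show ?thesis unfolding iq ip by simp
  next
    case False
    define \<kappa> where "\<kappa> = \<delta> * (3 * \<eta> + \<delta>)"
    have \<kappa>: "0 < \<kappa>" using \<delta> \<eta> by (simp add: \<kappa>_def add_nonneg_pos)
    have "\<delta> * a \<le> \<delta> * (\<eta> + \<delta>)" using False \<delta> by (intro mult_left_mono) auto
    then have \<kappa>_ge: "2 * \<delta> * \<eta> + \<delta> * a \<le> \<kappa>" by (simp add: \<kappa>_def algebra_simps)
    have err: "5 * \<kappa> / \<sigma> = 5 * M * (3 * \<eta> + M / sqrt n)"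
      using n by (simp add: \<kappa>_def \<sigma>_def \<delta>_def)
    have shift: "\<bar>thr (s * \<eta>) m - thr \<eta> m\<bar> \<le> 2 * \<delta> * \<eta>" "\<bar>s * a - a\<bar> \<le> \<delta> * a"
      if "\<bar>s - 1\<bar> < \<delta>" for s m
    proof -
      have "0 \<le> s" using that \<delta> by simp
      then have "\<bar>thr (s * \<eta>) m - thr \<eta> m\<bar> \<le> 2 * \<bar>s * \<eta> - \<eta>\<bar>"
        using \<eta> by (intro thr_lipschitz) auto
      also have "\<bar>s * \<eta> - \<eta>\<bar> = \<bar>s - 1\<bar> * \<eta>"
        using abs_mult[of "s - 1" "\<eta>"] \<eta> by (simp add: left_diff_distrib)
      also have "\<dots> \<le> \<delta> * \<eta>" using that \<eta> by (intro mult_right_mono) auto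
      finally show "\<bar>thr (s * \<eta>) m - thr \<eta> m\<bar> \<le> 2 * \<delta> * \<eta>" by simp
      have "\<bar>s * a - a\<bar> = \<bar>s - 1\<bar> * a"
        using abs_mult[of "s - 1" "a"] a by (simp add: left_diff_distrib)
      also have "\<dots> \<le> \<delta> * a" using that a by (intro mult_right_mono) auto
      finally show "\<bar>s * a - a\<bar> \<le> \<delta> * a" .
    qed
    define cl where "cl A \<theta> = measure (gauss \<theta> \<sigma>) {z. \<bar>thr \<eta> z - \<theta>\<bar> \<le> A}" for A \<theta>
    define op where "op A \<theta> = measure (gauss \<theta> \<sigma>) {z. \<bar>thr \<eta> z - \<theta>\<bar> < A}" for A \<theta>
    have cl_eq: "cl A \<theta> = measure (sample_dist n \<theta>) {y \<in> S \<theta>. \<bar>thr \<eta> (sample_mean n y) - \<theta>\<bar> \<le> A}" for A \<theta>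
      using prob_sample_mean[OF n1, of "{z. \<bar>thr \<eta> z - \<theta>\<bar> \<le> A}" \<theta>] by (simp add: cl_def \<sigma>_def S_def)
    have op_eq: "op A \<theta> = measure (sample_dist n \<theta>) {y \<in> S \<theta>. \<bar>thr \<eta> (sample_mean n y) - \<theta>\<bar> < A}" for A \<theta>
      using prob_sample_mean[OF n1, of "{z. \<bar>thr \<eta> z - \<theta>\<bar> < A}" \<theta>] by (simp add: op_def \<sigma>_def S_def)
    have meas_cl: "{y \<in> S \<theta>. \<bar>thr \<eta> (sample_mean n y) - \<theta>\<bar> \<le> A} \<in> sets (sample_dist n \<theta>)" for A \<theta>
      unfolding S_def by measurable
    have JD: "\<bar>c - \<theta>\<bar> \<le> h" if "\<theta> \<in> J c h" for c h \<theta>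
      using that J_upper[of c h] by (auto simp: abs_le_iff)
    have JI: "\<theta> \<in> J c h" if "\<bar>c - \<theta>\<bar> < h" for c h \<theta>
      using that J_lower[of c h] by (auto simp: abs_less_iff)
    \<comment> \<open>For \<open>a < \<kappa>\<close> the half-width 0 is used; the open interval is then empty.\<close>
    define a' where "a' = max 0 (a - \<kappa>)"
    have q_le: "q \<theta> \<le> cl (a + \<kappa>) \<theta> + 24 / M\<^sup>2" for \<theta>
      unfolding q_def cl_eq
    proof (rule measure_le_up_to[OF _ meas_cl meas_var_off prob_var_off], intro subsetI)
      fix y assume y: "y \<in> {y \<in> S \<theta>. \<theta> \<in> J (thr (sample_sd n y * \<eta>) (sample_mean n y)) (sample_sd n y * a)}"
      have "\<bar>thr \<eta> (sample_mean n y) - \<theta>\<bar> \<le> a + \<kappa>" if "y \<notin> var_off \<theta>"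
        using shift(1)[OF good[of y \<theta>], of "sample_mean n y"] shift(2)[OF good[of y \<theta>]] JD[of \<theta>] y that \<kappa>_ge by force
      with y show "y \<in> {y \<in> S \<theta>. \<bar>thr \<eta> (sample_mean n y) - \<theta>\<bar> \<le> a + \<kappa>} \<union> var_off \<theta>" by auto
    qed
    have q_ge: "op a' \<theta> \<le> q \<theta> + 24 / M\<^sup>2" for \<theta>
      unfolding q_def op_eq
    proof (rule measure_le_up_to[OF _ meas_q meas_var_off prob_var_off], intro subsetI)
      fix y assume y: "y \<in> {y \<in> S \<theta>. \<bar>thr \<eta> (sample_mean n y) - \<theta>\<bar> < a'}"
      have "\<bar>thr (sample_sd n y * \<eta>) (sample_mean n y) - \<theta>\<bar> < sample_sd n y * a" if "y \<notin> var_off \<theta>"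
        using shift(1)[OF good[of y \<theta>], of "sample_mean n y"] shift(2)[OF good[of y \<theta>]] y that \<kappa>_ge by (auto simp: a'_def max_def split: if_splits)
      with y JI show "y \<in> {y \<in> S \<theta>. \<theta> \<in> J (thr (sample_sd n y * \<eta>) (sample_mean n y)) (sample_sd n y * a)} \<union> var_off \<theta>"
        by blast
    qed
    have p_le: "p \<theta> \<le> cl (a' + \<kappa>) \<theta> + 0" for \<theta>
      unfolding p_def cl_eq
      by (rule measure_le_up_to[of _ _ "{}", OF _ meas_cl]) (auto simp: a'_def dest!: JD)
    have p_ge: "op a \<theta> \<le> p \<theta> + 0" for \<theta>
      unfolding p_def op_eq
      by (rule measure_le_up_to[of _ _ "{}", OF _ meas_p]) (auto intro!: JI)
    have nonneg: "0 \<le> cl A \<theta>" "0 \<le> op A \<theta>" for A \<theta> by (simp_all add: cl_def op_def)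
    have widen: "(INF \<theta>. cl (A + \<kappa>) \<theta>) \<le> (INF \<theta>. op A \<theta>) + 5 * \<kappa> / \<sigma>" if "0 \<le> A" for A
      unfolding cl_def op_def by (rule inf_coverage_widen[OF \<sigma> \<eta> that \<kappa>])
    have "(INF \<theta>. q \<theta>) \<le> (INF \<theta>. cl (a + \<kappa>) \<theta>) + 24 / M\<^sup>2"
      by (rule cINF_le_cINF_plus) (use q_le q01 in blast)+
    moreover have "(INF \<theta>. op a \<theta>) \<le> (INF \<theta>. p \<theta>) + 0"
      by (rule cINF_le_cINF_plus) (use p_ge nonneg in blast)+
    moreover have "(INF \<theta>. p \<theta>) \<le> (INF \<theta>. cl (a' + \<kappa>) \<theta>) + 0"
      by (rule cINF_le_cINF_plus) (use p_le p01 in blast)+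
    moreover have "(INF \<theta>. op a' \<theta>) \<le> (INF \<theta>. q \<theta>) + 24 / M\<^sup>2"
      by (rule cINF_le_cINF_plus) (use q_ge nonneg in blast)+
    ultimately have "\<bar>(INF \<theta>. q \<theta>) - (INF \<theta>. p \<theta>)\<bar> \<le> 24 / M\<^sup>2 + 5 * \<kappa> / \<sigma>"
      using widen[OF a] widen[of a'] by (simp add: a'_def abs_le_iff)
    moreover have "24 / M\<^sup>2 \<le> 28 / M\<^sup>2" by (intro divide_right_mono) auto
    ultimately show ?thesis unfolding iq ip err by linarith
  qed
qed

text \<open>The bound holds for every \<open>M\<close> as soon as \<open>n \<ge> 4 M\<^sup>2\<close>, and for fixed \<open>M\<close> its second term vanishes in the limit. Here
  \<open>\<eta> \<longlonglongrightarrow> 0\<close> enters: a threshold \<open>\<eta>\<close> makes the error \<open>1 / \<surd>n\<close> of the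
  standard deviation an error of order \<open>\<eta> / \<surd>n\<close> of the estimator, which has to be small
  compared with the spread \<open>1 / \<surd>n\<close> of the mean.\<close>

lemma inf_coverage_diff_tendsto_0:
  fixes \<eta> a :: "nat \<Rightarrow> real" and J :: "real \<Rightarrow> real \<Rightarrow> real set"
  assumes \<eta>: "\<And>n. 2 \<le> n \<Longrightarrow> 0 \<le> \<eta> n" "\<eta> \<longlonglongrightarrow> 0" and a: "\<And>n. 2 \<le> n \<Longrightarrow> 0 \<le> a n"
    and J: "\<And>c h. {c - h<..<c + h} \<subseteq> J c h" "\<And>c h. J c h \<subseteq> {c - h..c + h}"
      "\<And>\<theta>. Measurable.pred (borel \<Otimes>\<^sub>M borel) (\<lambda>p. \<theta> \<in> J (fst p) (snd p))"
  shows "(\<lambda>n. inf_coverage n (\<lambda>y. J (feasible_adaptive_lasso n (\<eta> n) y) (sample_sd n y * a n))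
      - inf_coverage n (\<lambda>y. J (adaptive_lasso n (\<eta> n) y) (a n))) \<longlonglongrightarrow> 0"
    (is "?D \<longlonglongrightarrow> 0")
proof (rule LIMSEQ_I)
  fix e :: real assume e: "0 < e"
  \<comment> \<open>Chosen so that the first term \<open>28 / M\<^sup>2\<close> of the bound is \<open>e / 2\<close>.\<close>
  define M where "M = sqrt (56 / e)"
  have M: "0 < M" "28 / M\<^sup>2 = e / 2" using e by (auto simp: M_def)
  have root: "(\<lambda>n. M / sqrt (real n)) \<longlonglongrightarrow> 0"
    by (intro tendsto_divide_0[OF tendsto_const] filterlim_at_top_imp_at_infinity
        filterlim_compose[OF sqrt_at_top filterlim_real_sequentially])
  have "(\<lambda>n. 5 * M * (3 * \<eta> n + M / sqrt (real n))) \<longlonglongrightarrow> 5 * M * (3 * 0 + 0)"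
    by (intro tendsto_intros \<eta> root)
  then have "\<forall>\<^sub>F n in sequentially. 5 * M * (3 * \<eta> n + M / sqrt (real n)) < e / 2"
    using e by (intro order_tendstoD(2)) auto
  moreover have "\<forall>\<^sub>F n in sequentially. M / sqrt (real n) < 1 / 2"
    by (rule order_tendstoD(2)[OF root]) simp
  ultimately have "\<forall>\<^sub>F n in sequentially. norm (?D n - 0) < e"
    using eventually_ge_at_top[of 2]
  proof eventually_elim
    case (elim n)
    then show ?case
      using inf_coverage_diff_bound[of n "\<eta> n" "a n" M J, OF _ \<eta>(1) a M(1) _ J] M(2) by force
  qed
  then show "\<exists>N. \<forall>n\<ge>N. norm (?D n - 0) < e" by (simp add: eventually_sequentially)
qed

theorem theorem10:
  fixes \<eta> a :: "nat \<Rightarrow> real"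
  assumes "\<And>n. n \<ge> 2 \<Longrightarrow> \<eta> n > 0"
    and "\<eta> \<longlonglongrightarrow> 0"
    and "\<And>n. n \<ge> 2 \<Longrightarrow> a n \<ge> 0"
  shows "((\<lambda>n. inf_coverage n (\<lambda>y. {feasible_adaptive_lasso n (\<eta> n) y - sample_sd n y * a n
                                  ..feasible_adaptive_lasso n (\<eta> n) y + sample_sd n y * a n})
             - inf_coverage n (\<lambda>y. {adaptive_lasso n (\<eta> n) y - a n
                                  ..adaptive_lasso n (\<eta> n) y + a n})) \<longlonglongrightarrow> 0) \<and>
         ((\<lambda>n. inf_coverage n (\<lambda>y. {feasible_adaptive_lasso n (\<eta> n) y - sample_sd n y * a n
                                  <..<feasible_adaptive_lasso n (\<eta> n) y + sample_sd n y * a n})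
             - inf_coverage n (\<lambda>y. {adaptive_lasso n (\<eta> n) y - a n
                                  <..<adaptive_lasso n (\<eta> n) y + a n})) \<longlonglongrightarrow> 0) \<and>
         ((\<lambda>n. inf_coverage n (\<lambda>y. {feasible_adaptive_lasso n (\<eta> n) y - sample_sd n y * a n
                                  <..feasible_adaptive_lasso n (\<eta> n) y + sample_sd n y * a n})
             - inf_coverage n (\<lambda>y. {adaptive_lasso n (\<eta> n) y - a n
                                  <..adaptive_lasso n (\<eta> n) y + a n})) \<longlonglongrightarrow> 0) \<and>
         ((\<lambda>n. inf_coverage n (\<lambda>y. {feasible_adaptive_lasso n (\<eta> n) y - sample_sd n y * a n
                                  ..<feasible_adaptive_lasso n (\<eta> n) y + sample_sd n y * a n})
             - inf_coverage n (\<lambda>y. {adaptive_lasso n (\<eta> n) y - a n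
                                  ..<adaptive_lasso n (\<eta> n) y + a n})) \<longlonglongrightarrow> 0)"
proof -
  have \<eta>: "0 \<le> \<eta> n" if "2 \<le> n" for n using assms(1)[OF that] by simp
  note lim = inf_coverage_diff_tendsto_0[OF \<eta> assms(2,3)]
  show ?thesis
    by (intro conjI lim[where J = "\<lambda>c h. {c - h..c + h}"] lim[where J = "\<lambda>c h. {c - h<..<c + h}"]
        lim[where J = "\<lambda>c h. {c - h<..c + h}"] lim[where J = "\<lambda>c h. {c - h..<c + h}"]) auto
qed

end
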